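(* Let $N\in\mathbb{N}\setminus\{0,1\}$, $s\in(0,1)$ and $p\in[1,\infty)$, and let $u\colon\mathbb{R}^N_+\to\mathbb{R}$ and $v,w\colon\partial\mathbb{R}^N_+\to\mathbb{R}$ be measurable functions. If $$\int_{\partial\mathbb{R}^N_+}\Bigl(\int_{\mathbb{R}^N_+}\frac{|v(x)-u(y)|^p}{|x-y|^{N+sp}}\,\mathrm{d}y\Bigr)\mathrm{d}x<\infty \quad\text{and}\quad \int_{\partial\mathbb{R}^N_+}\Bigl(\int_{\mathbb{R}^N_+}\frac{|w(x)-u(y)|^p}{|x-y|^{N+sp}}\,\mathrm{d}y\Bigr)\mathrm{d}x<\infty,$$ then $v=w$ almost everywhere in $\partial\mathbb{R}^N_+$.
   Context: $\mathbb{R}^N_+ = \mathbb{R}^{N-1}\times(0,\infty)$. Its boundary $\partial\mathbb{R}^N_+ = \mathbb{R}^{N-1}\times\{0\}$ is identified with $\mathbb{R}^{N-1}$ and carries the $(N-1)$-dimensional Lebesgue measure; $|x-y|$ is the Euclidean distance in $\mathbb{R}^N$. *)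

theory Defs
  imports "HOL-Analysis.Analysis"
begin

text \<open>
  With \<open>N - 1 = CARD('n)\<close>, the space \<open>\<real>\<^sup>N\<close> is \<open>(real ^ 'n) \<times> real\<close>; the norm, the distance and
  the Lebesgue measure that the library puts on this product are the Euclidean ones. A point \<open>x\<close> of
  \<open>real ^ 'n\<close> stands for the boundary point \<open>(x, 0)\<close>.
\<close>

definition half_space :: "((real ^ 'n) \<times> real) set" where
  "half_space = UNIV \<times> {0<..}"

end

theory Submission
  imports Defs
begin

text \<open>
  The proof is pointwise in the boundary variable. Put \<open>a = N + s * p\<close>. Since \<open>a > N\<close>, the kernel
  \<open>1 / dist (x, 0) y powr a\<close> has, at each boundary point \<open>x\<close>, a singularity that is too strong to be
  integrable over the half-space (\<open>nn_integral_kernel_half_space_eq_top\<close>). On the other hand, the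
  quasi-triangle inequality \<open>abs_diff_powr_le\<close> dominates the kernel times the constant
  \<open>\<bar>v x - w x\<bar> powr p\<close> by a multiple of the sum of the two integrands. If both inner integrals
  are finite at \<open>x\<close>, that constant therefore vanishes
  (\<open>finite_energy_imp_unique_boundary_value\<close>).

  Finiteness of the outer integrals gives finiteness of the inner ones almost everywhere, provided
  that the inner integrals depend measurably on \<open>x\<close>, which is the purpose of
  \<open>borel_measurable_boundary_energy\<close>: the integral is a supremum over the simple functions below
  the integrand, so for an integrand that is not measurable it could be finite although the
  integrand is infinite on a set that is not negligible.
\<close>

lemma abs_diff_powr_le:
  fixes a b c p :: real
  assumes "0 \<le> p"
  shows "\<bar>a - b\<bar> powr p \<le> 2 powr p * (\<bar>a - c\<bar> powr p + \<bar>b - c\<bar> powr p)"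
proof -
  define m where "m = max \<bar>a - c\<bar> \<bar>b - c\<bar>"
  have "\<bar>a - b\<bar> powr p \<le> (2 * m) powr p"
    using assms by (intro powr_mono2) (auto simp: m_def max_def abs_if)
  also have "\<dots> = 2 powr p * m powr p"
    by (rule powr_mult)
  also have "m powr p \<le> \<bar>a - c\<bar> powr p + \<bar>b - c\<bar> powr p"
    by (auto simp: m_def max_def)
  finally show ?thesis
    by simp
qed

lemma sets_half_space [measurable]: "half_space \<in> sets borel"
  unfolding half_space_def by (intro borel_open open_Times) auto

lemma sigma_finite_completion:
  assumes "sigma_finite_measure M"
  shows "sigma_finite_measure (completion M)"
proof -
  from assms obtain A where "countable A" "A \<subseteq> sets M" "\<Union>A = space M"
    "\<forall>a\<in>A. emeasure M a \<noteq> \<infinity>"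
    unfolding sigma_finite_measure_def by blast
  thus ?thesis
    unfolding sigma_finite_measure_def by (intro exI[of _ A]) auto
qed

lemma measurable_lebesgue_on_borel:
  assumes "f \<in> borel_measurable borel"
  shows "f \<in> borel_measurable (lebesgue_on S)"
  using assms by (intro measurable_restrict_space1 measurable_completion) simp

text \<open>
  For every \<open>r\<close>, the ball of radius \<open>r / 2\<close> about \<open>(x, r / 2)\<close> touches the boundary at
  \<open>(x, 0)\<close> from inside the half-space. Its volume is of order \<open>r\<close> to the power of the dimension, and
  the kernel is at least \<open>r powr - a\<close> on it, so the integral is bounded below by a multiple of a
  negative power of \<open>r\<close>, which is unbounded as \<open>r\<close> tends to \<open>0\<close>.
\<close>
lemma nn_integral_kernel_half_space_eq_top:
  fixes x :: "real ^ 'n" and a :: real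
  assumes "real (CARD('n) + 1) < a"
  shows "(\<integral>\<^sup>+ y. ennreal (1 / dist (x, 0) y powr a) \<partial>lebesgue_on half_space) = \<infinity>"
    (is "?I = \<infinity>")
proof (rule ccontr)
  define n where "n = CARD('n) + 1"
  define d where "d = a - real n"
  define k where "k = unit_ball_vol (real n) / 2 ^ n"
  have d: "d > 0" using assms by (simp add: d_def n_def)
  have k: "k > 0" by (simp add: k_def)
  have lower: "ennreal (k * r powr - d) \<le> ?I" if r: "r > 0" for r :: real
  proof -
    let ?B = "ball (x, r / 2) (r / 2)"
    have sub: "?B \<subseteq> half_space"
    proof
      fix y assume "y \<in> ?B"
      hence "dist (x, r / 2) y < r / 2" by simp
      moreover have "dist (r / 2) (snd y) \<le> dist (x, r / 2) y"
        using dist_snd_le[of "(x, r / 2)" y] by simp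
      ultimately have "snd y > 0" by (simp add: dist_real_def)
      thus "y \<in> half_space" by (cases y) (auto simp: half_space_def)
    qed
    have le: "1 / r powr a \<le> 1 / dist (x, 0) y powr a" if y: "y \<in> ?B" for y
    proof -
      have "dist (x, 0) y \<le> dist (x, 0) (x, r / 2) + dist (x, r / 2) y"
        by (rule dist_triangle)
      also have "dist (x, 0) (x, r / 2) = r / 2"
        using r by (simp add: dist_Pair_Pair dist_real_def)
      finally have "dist (x, 0) y \<le> r" using y by simp
      moreover have "0 < snd y"
        using y sub by (auto simp: half_space_def)
      hence "0 < dist (x, 0) y" by auto
      moreover from this have "0 < dist (x, 0) y powr a" by simp
      ultimately show ?thesis
        using assms r by (intro divide_left_mono powr_mono2 mult_pos_pos) auto
    qed
    have "ennreal (k * r powr - d) =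
        ennreal (1 / r powr a) * ennreal (unit_ball_vol (real n) * (r / 2) ^ n)"
    proof -
      have "r powr - d = r powr real n / r powr a"
        by (simp add: d_def powr_diff)
      hence "k * r powr - d = 1 / r powr a * (unit_ball_vol (real n) * (r / 2) ^ n)"
        using r by (simp add: k_def powr_realpow power_divide)
      thus ?thesis using r by (subst ennreal_mult [symmetric]) simp_all
    qed
    also have "ennreal (unit_ball_vol (real n) * (r / 2) ^ n) = emeasure lebesgue ?B"
      using r by (simp add: emeasure_ball n_def)
    also have "emeasure lebesgue ?B = emeasure (lebesgue_on half_space) ?B"
      using sub by (subst emeasure_restrict_space) auto
    also have "ennreal (1 / r powr a) * \<dots> =
        (\<integral>\<^sup>+ y. ennreal (1 / r powr a) * indicator ?B y \<partial>lebesgue_on half_space)"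
      using sub by (subst nn_integral_cmult_indicator) (auto simp: sets_restrict_space_iff)
    also have "\<dots> \<le> ?I"
      using le by (intro nn_integral_mono) (auto simp: indicator_def intro!: ennreal_leI)
    finally show ?thesis .
  qed
  assume "?I \<noteq> \<infinity>"
  then obtain M where M: "?I = ennreal M" "M \<ge> 0"
    by (cases ?I) auto
  \<comment> \<open>The radius at which the lower bound takes the value \<open>M + 1\<close>.\<close>
  define r where "r = ((M + 1) / k) powr (- 1 / d)"
  have "r > 0" using M k by (simp add: r_def)
  moreover have "r powr - d = (M + 1) / k"
    using M k d by (simp add: r_def powr_powr)
  ultimately have "ennreal (M + 1) \<le> ennreal M"
    using lower[of r] k M by simp
  thus False using M by (simp add: ennreal_le_iff)
qed

lemma finite_energy_imp_unique_boundary_value: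
  fixes x :: "real ^ 'n" and a p b c :: real
  assumes a: "real (CARD('n) + 1) < a" and p: "0 \<le> p"
    and u [measurable]: "u \<in> borel_measurable (lebesgue_on half_space)"
    and b: "(\<integral>\<^sup>+ y. ennreal (\<bar>b - u y\<bar> powr p / dist (x, 0) y powr a) \<partial>lebesgue_on half_space) < \<infinity>"
    and c: "(\<integral>\<^sup>+ y. ennreal (\<bar>c - u y\<bar> powr p / dist (x, 0) y powr a) \<partial>lebesgue_on half_space) < \<infinity>"
  shows "b = c"
proof (rule ccontr)
  assume "b \<noteq> c"
  let ?K = "\<lambda>y. dist (x, 0) y powr a"
  let ?f = "\<lambda>t y. ennreal (\<bar>t - u y\<bar> powr p / ?K y)"
  have [measurable]: "?K \<in> borel_measurable (lebesgue_on half_space)"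
    by (rule measurable_lebesgue_on_borel) measurable
  have "ennreal (\<bar>b - c\<bar> powr p) * (\<integral>\<^sup>+ y. ennreal (1 / ?K y) \<partial>lebesgue_on half_space)
      = (\<integral>\<^sup>+ y. ennreal (\<bar>b - c\<bar> powr p / ?K y) \<partial>lebesgue_on half_space)"
    by (subst nn_integral_cmult [symmetric]) (simp_all add: ennreal_mult [symmetric])
  also have "\<dots> \<le> (\<integral>\<^sup>+ y. ennreal (2 powr p) * (?f b y + ?f c y) \<partial>lebesgue_on half_space)"
  proof (intro nn_integral_mono)
    fix y
    have "\<bar>b - c\<bar> powr p / ?K y
        \<le> 2 powr p * (\<bar>b - u y\<bar> powr p + \<bar>c - u y\<bar> powr p) / ?K y"
      using p by (intro divide_right_mono abs_diff_powr_le) auto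
    thus "ennreal (\<bar>b - c\<bar> powr p / ?K y) \<le> ennreal (2 powr p) * (?f b y + ?f c y)"
      by (simp add: ennreal_mult [symmetric] ennreal_plus [symmetric] add_divide_distrib
          distrib_left ennreal_leI del: ennreal_plus)
  qed
  also have "\<dots> = ennreal (2 powr p) * (integral\<^sup>N (lebesgue_on half_space) (?f b)
      + integral\<^sup>N (lebesgue_on half_space) (?f c))"
    by (simp add: nn_integral_cmult nn_integral_add)
  also have "\<dots> < \<infinity>"
    using b c by (simp add: ennreal_mult_less_top)
  finally show False
    using \<open>b \<noteq> c\<close> by (simp add: nn_integral_kernel_half_space_eq_top[OF a] ennreal_mult_top)
qed

lemma borel_measurable_boundary_energy:
  fixes v :: "real ^ 'n \<Rightarrow> real"
  assumes [measurable]: "u \<in> borel_measurable (lebesgue_on half_space)"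
    "v \<in> borel_measurable lebesgue"
  shows "(\<lambda>x. \<integral>\<^sup>+ y. ennreal (\<bar>v x - u y\<bar> powr p / dist (x, 0) y powr a) \<partial>lebesgue_on half_space)
    \<in> borel_measurable lebesgue"
proof -
  interpret sigma_finite_measure "lebesgue_on (half_space :: ((real ^ 'n) \<times> real) set)"
    by (intro sigma_finite_measure_restrict_space sigma_finite_completion sigma_finite_lborel)
      simp
  \<comment> \<open>The distance is Borel in both variables, whereas the product below is taken between two
    completed spaces; the identity maps carry the distance over to it.\<close>
  have [measurable]: "(\<lambda>x::real ^ 'n. x) \<in> lebesgue \<rightarrow>\<^sub>M borel"
    by (intro measurable_completion) simp
  have [measurable]: "(\<lambda>y. y) \<in> borel_measurable (lebesgue_on (half_space :: ((real ^ 'n) \<times> real) set))"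
    by (rule measurable_lebesgue_on_borel) simp
  show ?thesis
    by measurable
qed

theorem theorem5p1:
  fixes N :: nat and s p :: real
    and u :: "(real ^ 'n) \<times> real \<Rightarrow> real"
    and v w :: "real ^ 'n \<Rightarrow> real"
  assumes "N \<ge> 2" and "CARD('n) = N - 1"
    and "0 < s" and "s < 1" and "1 \<le> p"
    and "u \<in> borel_measurable (lebesgue_on half_space)"
    and "v \<in> borel_measurable lebesgue"
    and "w \<in> borel_measurable lebesgue"
    and "(\<integral>\<^sup>+ x. (\<integral>\<^sup>+ y. ennreal (\<bar>v x - u y\<bar> powr p / dist (x, 0) y powr (real N + s * p))
            \<partial>lebesgue_on half_space) \<partial>lebesgue) < \<infinity>"
    and "(\<integral>\<^sup>+ x. (\<integral>\<^sup>+ y. ennreal (\<bar>w x - u y\<bar> powr p / dist (x, 0) y powr (real N + s * p))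
            \<partial>lebesgue_on half_space) \<partial>lebesgue) < \<infinity>"
  shows "AE x in lebesgue. v x = w x"
proof -
  let ?J = "\<lambda>t x. \<integral>\<^sup>+ y. ennreal (\<bar>t - u y\<bar> powr p / dist (x, 0) y powr (real N + s * p))
    \<partial>lebesgue_on half_space"
  have "AE x in lebesgue. ?J (v x) x \<noteq> \<infinity>"
    using assms by (intro nn_integral_PInf_AE borel_measurable_boundary_energy) auto
  moreover have "AE x in lebesgue. ?J (w x) x \<noteq> \<infinity>"
    using assms by (intro nn_integral_PInf_AE borel_measurable_boundary_energy) auto
  ultimately show ?thesis
  proof eventually_elim
    case (elim x)
    have "real (CARD('n) + 1) < real N + s * p"
      using assms by simp
    thus ?case
      using elim assms
      by (intro finite_energy_imp_unique_boundary_value[of "real N + s * p" p u "v x" x "w x"])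
        (auto simp: less_top)
  qed
qed

end
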